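(* For every integer $n\ge2$, it is not the case that $(2n-2;n,n)\xrightarrow{\textsc{ad}} n$; hence $\textsc{ad}(2n-2;n,n)<n$. That is, there is an instance of the admissible division problem with $2n-2$ agents and two cakes, each cut into $n$ slices, such that for every partition $P$, $\nu^D(P)\le n-1$.
   Context: Admissible division. Let $\Delta_{a-1}=\{x\in\mathbb{R}^a_{\ge0}:\sum_i x_i=1\}$ and $\mathcal{P}=\prod_{t=1}^d\Delta_{a_t-1}$; $P=(P^1,\ldots,P^d)\in\mathcal{P}$ represents a division of $d$ cakes (copies of $[0,1]$), cake $t$ cut into $a_t$ consecutive slices of lengths $P^t_1,\ldots,P^t_{a_t}$. Let $\mathcal{J}=[a_1]\times\cdots\times[a_d]$; $\vec j=(j_1,\ldots,j_d)$ denotes the $d$-tuple consisting of slice $j_t$ of cake $t$. An instance with $n$ agents consists of, for each agent $i$, a map $L^i$ assigning to every $P\in\mathcal{P}$ a set $L^i(P)\subseteq\mathcal{J}$ such that (i) for each $\vec j$ the set $\{P:\vec j\in L^i(P)\}$ is closed, and (ii) for every $P$ there is $\vec j\in L^i(P)$ with $P^t_{j_t}>0$ for all $t$. $\nu^D(P)$ is the largest size of a set $Q$ of agents with a map $\phi:Q\to\mathcal{J}$ such that $\phi(q)\in L^q(P)$ for all $q$ and distinct $q,q'$ get vectors differing in every coordinate. $(n;a_1,\ldots,a_d)\xrightarrow{\textsc{ad}} m$ means that for every instance with $n$ agents some $P$ has $\nu^D(P)\ge m$; $\textsc{ad}(n;a_1,\ldots,a_d)$ is the largest such $m$. *)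

theory Defs
  imports "HOL-Homology.Homology"
begin

text \<open>A list \<open>as\<close> records the numbers of slices \<open>a\<^sub>1, \<dots>, a\<^sub>d\<close> (all assumed positive).
  Cakes, slices and agents are numbered from \<open>0\<close>. The set \<open>divisions as\<close> is the product of
  simplices; it carries the subspace topology of the product topology on
  \<open>nat \<Rightarrow> nat \<Rightarrow> real\<close>, in which all coordinates outside the relevant range are constant.\<close>

definition divisions :: "nat list \<Rightarrow> (nat \<Rightarrow> nat \<Rightarrow> real) set" where
  "divisions as = (\<Pi>\<^sub>E t\<in>{..<length as}. standard_simplex (as ! t - 1))"

definition slice_tuples :: "nat list \<Rightarrow> (nat \<Rightarrow> nat) set" where
  "slice_tuples as = (\<Pi>\<^sub>E t\<in>{..<length as}. {..<as ! t})"

definition ad_instance ::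
  "nat \<Rightarrow> nat list \<Rightarrow> (nat \<Rightarrow> (nat \<Rightarrow> nat \<Rightarrow> real) \<Rightarrow> (nat \<Rightarrow> nat) set) \<Rightarrow> bool" where
  "ad_instance n as L \<longleftrightarrow> (\<forall>i<n.
     (\<forall>P\<in>divisions as. L i P \<subseteq> slice_tuples as) \<and>
     (\<forall>j\<in>slice_tuples as.
        closedin (top_of_set (divisions as)) {P \<in> divisions as. j \<in> L i P}) \<and>
     (\<forall>P\<in>divisions as. \<exists>j\<in>L i P. \<forall>t<length as. P t (j t) > 0))"

definition ad_matching ::
  "nat \<Rightarrow> nat list \<Rightarrow> (nat \<Rightarrow> (nat \<Rightarrow> nat \<Rightarrow> real) \<Rightarrow> (nat \<Rightarrow> nat) set) \<Rightarrow>
   (nat \<Rightarrow> nat \<Rightarrow> real) \<Rightarrow> nat set \<Rightarrow> (nat \<Rightarrow> nat \<Rightarrow> nat) \<Rightarrow> bool" where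
  "ad_matching n as L P Q \<phi> \<longleftrightarrow>
     Q \<subseteq> {..<n} \<and> (\<forall>q\<in>Q. \<phi> q \<in> L q P) \<and>
     (\<forall>q\<in>Q. \<forall>q'\<in>Q. q \<noteq> q' \<longrightarrow> (\<forall>t<length as. \<phi> q t \<noteq> \<phi> q' t))"

definition nu_D ::
  "nat \<Rightarrow> nat list \<Rightarrow> (nat \<Rightarrow> (nat \<Rightarrow> nat \<Rightarrow> real) \<Rightarrow> (nat \<Rightarrow> nat) set) \<Rightarrow>
   (nat \<Rightarrow> nat \<Rightarrow> real) \<Rightarrow> nat" where
  "nu_D n as L P = Max {card Q |Q. \<exists>\<phi>. ad_matching n as L P Q \<phi>}"

definition ad_arrow :: "nat \<Rightarrow> nat list \<Rightarrow> nat \<Rightarrow> bool" where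
  "ad_arrow n as m \<longleftrightarrow>
     (\<forall>L. ad_instance n as L \<longrightarrow> (\<exists>P\<in>divisions as. nu_D n as L P \<ge> m))"

definition ad_number :: "nat \<Rightarrow> nat list \<Rightarrow> nat" where
  "ad_number n as = (GREATEST m. ad_arrow n as m)"

text \<open>The maximum defining \<open>nu_D\<close> is over a finite nonempty set.\<close>

lemma finite_ad_matching_cards:
  "finite {card Q |Q. \<exists>\<phi>. ad_matching n as L P Q \<phi>}"
proof (rule finite_subset)
  show "{card Q |Q. \<exists>\<phi>. ad_matching n as L P Q \<phi>} \<subseteq> card ` Pow {..<n}"
    by (auto simp: ad_matching_def)
qed simp

lemma ad_matching_empty: "ad_matching n as L P {} \<phi>"
  by (simp add: ad_matching_def)

lemma le_nu_D_iff:
  "m \<le> nu_D n as L P \<longleftrightarrow> (\<exists>Q \<phi>. ad_matching n as L P Q \<phi> \<and> m \<le> card Q)"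
proof -
  have "{card Q |Q. \<exists>\<phi>. ad_matching n as L P Q \<phi>} \<noteq> {}"
    using ad_matching_empty by blast
  then show ?thesis
    unfolding nu_D_def by (subst Max_ge_iff[OF finite_ad_matching_cards]) auto
qed

end

theory Submission
  imports Defs "HOL-Analysis.Abstract_Topological_Spaces"
begin

text \<open>Let \<open>p\<close> and \<open>q\<close> be two permutations of the \<open>n\<close> slices whose graphs together form a cycle of length
  \<open>2 n\<close>; these graphs are its only perfect matchings. A division \<open>(x, y)\<close> is read as a pair of marginals,
  and an agent considers the transport plans from \<open>x\<close> to \<open>y\<close> that put as much mass as possible on the
  cycle. Agents of the first kind (\<open>n - 1\<close> of them) take only such plans that vanish at some edge of \<open>q\<close>,
  those of the second kind (the other \<open>n - 1\<close>) only such plans that vanish at some edge of \<open>p\<close>; each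
  accepts the pairs of slices where such a plan is largest.

  If \<open>n\<close> agents were matched, both kinds would occur, and the average of their plans would be an optimal
  plan that is positive on a perfect matching. Optimality forces this matching to be \<open>p\<close> or \<open>q\<close>, say \<open>p\<close>, and then
  forces the support into the cycle. Plans supported on the cycle differ by a multiple of \<open>p - q\<close>. At
  an edge of \<open>p\<close> where a plan of the second kind vanishes, a plan of the first kind would then be
  minimal and maximal among the edges of \<open>p\<close> at once, which leaves no edge of \<open>p\<close> to the second kind.\<close>

section \<open>Transport plans\<close>

text \<open>Entries outside the \<open>n\<close> by \<open>n\<close> block are fixed to 0, so that
  the plans with given marginals form a compact set of functions.\<close>

definition plan :: "nat \<Rightarrow> (nat \<Rightarrow> real) \<Rightarrow> (nat \<Rightarrow> real) \<Rightarrow> (nat \<Rightarrow> nat \<Rightarrow> real) \<Rightarrow> bool" where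
  "plan n x y T \<longleftrightarrow> (\<forall>i j. 0 \<le> T i j) \<and> (\<forall>i j. \<not> (i < n \<and> j < n) \<longrightarrow> T i j = 0) \<and>
     (\<forall>i<n. (\<Sum>j<n. T i j) = x i) \<and> (\<forall>j<n. (\<Sum>i<n. T i j) = y j)"

definition perm_mat :: "nat \<Rightarrow> (nat \<Rightarrow> nat) \<Rightarrow> nat \<Rightarrow> nat \<Rightarrow> real" where
  "perm_mat n p i j = (if i < n \<and> j = p i then 1 else 0)"

definition mass :: "nat \<Rightarrow> (nat \<Rightarrow> nat) \<Rightarrow> (nat \<Rightarrow> nat) \<Rightarrow> (nat \<Rightarrow> nat \<Rightarrow> real) \<Rightarrow> real" where
  "mass n p q T = (\<Sum>i<n. T i (p i) + T i (q i))"

definition opt_plan ::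
  "nat \<Rightarrow> (nat \<Rightarrow> nat) \<Rightarrow> (nat \<Rightarrow> nat) \<Rightarrow> (nat \<Rightarrow> real) \<Rightarrow> (nat \<Rightarrow> real) \<Rightarrow> (nat \<Rightarrow> nat \<Rightarrow> real) \<Rightarrow> bool" where
  "opt_plan n p q x y T \<longleftrightarrow>
     plan n x y T \<and> (\<forall>T'. plan n x y T' \<longrightarrow> mass n p q T' \<le> mass n p q T)"

text \<open>The union of the two permutation graphs is a single cycle of length \<open>2 n\<close>: the last clause
  says that the permutation \<open>p\<^sup>-\<^sup>1 q\<close> acts transitively.\<close>

definition two_matching_cycle :: "nat \<Rightarrow> (nat \<Rightarrow> nat) \<Rightarrow> (nat \<Rightarrow> nat) \<Rightarrow> bool" where
  "two_matching_cycle n p q \<longleftrightarrow>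
     bij_betw p {..<n} {..<n} \<and> bij_betw q {..<n} {..<n} \<and> (\<forall>i<n. p i \<noteq> q i) \<and>
     (\<forall>S\<subseteq>{..<n}. S \<noteq> {} \<longrightarrow> (\<forall>k\<in>S. \<forall>l<n. p l = q k \<longrightarrow> l \<in> S) \<longrightarrow> S = {..<n})"

text \<open>Swapping the permutations inverts \<open>p^-1 q\<close>, and a set is closed under a
  permutation exactly when its complement is closed under the inverse.\<close>

lemma two_matching_cycle_commute:
  assumes "two_matching_cycle n p q"
  shows "two_matching_cycle n q p"
  unfolding two_matching_cycle_def
proof (intro conjI allI impI)
  show "bij_betw p {..<n} {..<n}" "bij_betw q {..<n} {..<n}" "\<And>i. i < n \<Longrightarrow> q i \<noteq> p i"
    using assms by (auto simp: two_matching_cycle_def)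
next
  fix S assume S: "S \<subseteq> {..<n}" "S \<noteq> {}" "\<forall>k\<in>S. \<forall>l<n. q l = p k \<longrightarrow> l \<in> S"
  have "\<forall>k\<in>{..<n} - S. \<forall>l<n. p l = q k \<longrightarrow> l \<in> {..<n} - S"
    using S(3) by (metis DiffD1 DiffD2 DiffI lessThan_iff)
  then have "{..<n} - S = {} \<or> {..<n} - S = {..<n}"
    using assms unfolding two_matching_cycle_def by (meson Diff_subset)
  then show "S = {..<n}" using S by blast
qed

lemma mass_commute: "mass n p q = mass n q p"
  by (simp add: mass_def fun_eq_iff add.commute)

lemma opt_plan_commute: "opt_plan n p q = opt_plan n q p"
  by (simp add: opt_plan_def fun_eq_iff mass_commute)

lemma planD:
  assumes "plan n x y T"
  shows "0 \<le> T i j" "\<not> (i < n \<and> j < n) \<Longrightarrow> T i j = 0"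
  using assms by (auto simp: plan_def)

lemma plan_le_row:
  assumes "plan n x y T" "i < n" "j < n"
  shows "T i j \<le> x i"
proof -
  have "T i j \<le> (\<Sum>j<n. T i j)"
    using assms by (intro member_le_sum) (auto simp: plan_def)
  then show ?thesis using assms by (simp add: plan_def)
qed

lemma plan_le_col:
  assumes "plan n x y T" "i < n" "j < n"
  shows "T i j \<le> y j"
proof -
  have "T i j \<le> (\<Sum>i<n. T i j)"
    using assms by (intro member_le_sum[of i _ "\<lambda>i. T i j"]) (auto simp: plan_def)
  then show ?thesis using assms by (simp add: plan_def)
qed

lemma plan_perturb:
  assumes "plan n x y T"
    and "\<And>i j. 0 \<le> T i j + D i j" "\<And>i j. \<not> (i < n \<and> j < n) \<Longrightarrow> D i j = 0"
    and "\<And>i. i < n \<Longrightarrow> (\<Sum>j<n. D i j) = 0" "\<And>j. j < n \<Longrightarrow> (\<Sum>i<n. D i j) = 0"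
  shows "plan n x y (\<lambda>i j. T i j + D i j)"
  using assms by (auto simp: plan_def sum.distrib)

lemma plan_average:
  assumes "\<And>m. m < n \<Longrightarrow> plan n x y (T m)" "0 < n"
  shows "plan n x y (\<lambda>i j. (\<Sum>m<n. T m i j) / n)"
proof -
  have row: "(\<Sum>j<n. (\<Sum>m<n. T m i j) / n) = x i" if "i < n" for i
  proof -
    have "(\<Sum>j<n. (\<Sum>m<n. T m i j) / n) = (\<Sum>m<n. \<Sum>j<n. T m i j) / n"
      by (subst sum.swap) (simp add: sum_divide_distrib)
    also have "(\<Sum>m<n. \<Sum>j<n. T m i j) = (\<Sum>m<n. x i)"
      using assms(1) that by (intro sum.cong) (auto simp: plan_def)
    finally show ?thesis using assms(2) by simp
  qed
  have col: "(\<Sum>i<n. (\<Sum>m<n. T m i j) / n) = y j" if "j < n" for j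
  proof -
    have "(\<Sum>i<n. (\<Sum>m<n. T m i j) / n) = (\<Sum>m<n. \<Sum>i<n. T m i j) / n"
      by (subst sum.swap) (simp add: sum_divide_distrib)
    also have "(\<Sum>m<n. \<Sum>i<n. T m i j) = (\<Sum>m<n. y j)"
      using assms(1) that by (intro sum.cong) (auto simp: plan_def)
    finally show ?thesis using assms(2) by simp
  qed
  have "0 \<le> (\<Sum>m<n. T m i j) / n" for i j
    using assms(1) by (intro divide_nonneg_nonneg sum_nonneg) (auto simp: plan_def)
  moreover have "(\<Sum>m<n. T m i j) / n = 0" if "\<not> (i < n \<and> j < n)" for i j
    using assms(1) that by (simp add: plan_def)
  ultimately show ?thesis using row col by (auto simp: plan_def)
qed

lemma mass_average:
  "mass n p q (\<lambda>i j. (\<Sum>m<n. T m i j) / n) = (\<Sum>m<n. mass n p q (T m)) / n"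
proof -
  have "mass n p q (\<lambda>i j. (\<Sum>m<n. T m i j) / n) = (\<Sum>i<n. (\<Sum>m<n. T m i (p i) + T m i (q i))) / n"
    by (simp add: mass_def sum.distrib sum_divide_distrib add_divide_distrib)
  then show ?thesis by (subst (asm) sum.swap) (simp add: mass_def)
qed

text \<open>Mass is linear and all the given plans attain the same maximum, so their average attains
  it too.\<close>

lemma opt_plan_average:
  assumes "\<And>m. m < n \<Longrightarrow> opt_plan n p q x y (T m)" "0 < n"
  shows "opt_plan n p q x y (\<lambda>i j. (\<Sum>m<n. T m i j) / n)"
proof -
  define c where "c = mass n p q (T 0)"
  have "mass n p q (T m) = c" if "m < n" for m
    using assms(1)[OF that] assms(1)[OF assms(2)] unfolding c_def
    by (intro antisym) (auto simp: opt_plan_def)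
  then have "mass n p q (\<lambda>i j. (\<Sum>m<n. T m i j) / n) = c"
    using assms(2) by (simp add: mass_average)
  moreover have "plan n x y (\<lambda>i j. (\<Sum>m<n. T m i j) / n)"
    using assms by (intro plan_average) (auto simp: opt_plan_def)
  ultimately show ?thesis
    using assms(1)[OF assms(2)] by (simp add: opt_plan_def c_def)
qed

text \<open>The product coupling, normalised by the total mass. The total \<open>s\<close> is left
  general because \<open>plan_extend_scaled\<close> needs a remainder of mass
  \<open>1 - c\<close>.\<close>

lemma plan_exists:
  assumes "\<And>i. i < n \<Longrightarrow> 0 \<le> x i" "\<And>j. j < n \<Longrightarrow> 0 \<le> y j"
    and "(\<Sum>i<n. x i) = s" "(\<Sum>j<n. y j) = s" "0 < s"
  shows "\<exists>T. plan n x y T"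
proof
  let ?T = "\<lambda>i j. if i < n \<and> j < n then x i * y j / s else 0"
  have "(\<Sum>j<n. ?T i j) = x i" if "i < n" for i
  proof -
    have "(\<Sum>j<n. ?T i j) = x i * (\<Sum>j<n. y j) / s"
      using that by (simp add: sum_distrib_left sum_divide_distrib)
    then show ?thesis using assms by simp
  qed
  moreover have "(\<Sum>i<n. ?T i j) = y j" if "j < n" for j
  proof -
    have "(\<Sum>i<n. ?T i j) = (\<Sum>i<n. x i) * y j / s"
      using that by (simp add: sum_distrib_right sum_divide_distrib)
    then show ?thesis using assms by simp
  qed
  ultimately show "plan n x y ?T"
    using assms by (auto simp: plan_def)
qed

lemma sum_perm_mat_row:
  assumes "bij_betw p {..<n} {..<n}" "i < n"
  shows "(\<Sum>j<n. perm_mat n p i j) = 1"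
proof -
  have "p i < n" using assms bij_betwE by blast
  then show ?thesis using assms by (simp add: perm_mat_def sum.delta)
qed

lemma sum_perm_mat_col:
  assumes "bij_betw p {..<n} {..<n}" "j < n"
  shows "(\<Sum>i<n. perm_mat n p i j) = 1"
proof -
  have "(\<Sum>i<n. perm_mat n p i j) = (\<Sum>i<n. if j = p i then 1 else 0)"
    by (rule sum.cong) (auto simp: perm_mat_def)
  also have "\<dots> = (\<Sum>k<n. if j = k then 1 else 0)"
    by (rule sum.reindex_bij_betw[OF assms(1), where g = "\<lambda>k. if j = k then 1 else 0"])
  finally show ?thesis using assms(2) by simp
qed

text \<open>Permutation matrices have equal row and column sums, and only entries on the graph of
  \<open>r\<close> can decrease, by at most \<open>t\<close>.\<close>

lemma plan_exchange:
  assumes "plan n x y T" and p: "bij_betw p {..<n} {..<n}" and r: "bij_betw r {..<n} {..<n}"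
    and "0 \<le> t" "\<And>k. k < n \<Longrightarrow> t \<le> T k (r k)"
  shows "plan n x y (\<lambda>i j. T i j + t * (perm_mat n p i j - perm_mat n r i j))"
proof (rule plan_perturb[OF assms(1)])
  show "0 \<le> T i j + t * (perm_mat n p i j - perm_mat n r i j)" for i j
    using assms(4,5) planD(1)[OF assms(1), of i j] by (auto simp: perm_mat_def)
  show "t * (perm_mat n p i j - perm_mat n r i j) = 0" if "\<not> (i < n \<and> j < n)" for i j
    using that bij_betwE[OF p] bij_betwE[OF r] by (auto simp: perm_mat_def)
qed (simp_all add: sum_distrib_left[symmetric] sum_subtractf
      sum_perm_mat_row[OF p] sum_perm_mat_row[OF r] sum_perm_mat_col[OF p] sum_perm_mat_col[OF r])

lemma mass_exchange:
  "mass n p q (\<lambda>i j. T i j + t * (D i j - E i j)) = mass n p q T + t * (mass n p q D - mass n p q E)"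
  by (simp add: mass_def sum.distrib sum_subtractf sum_distrib_left algebra_simps)

lemma mass_perm_mat:
  "mass n p q (perm_mat n r) = (\<Sum>i<n. of_bool (p i = r i) + of_bool (q i = r i))"
  unfolding mass_def by (rule sum.cong) (auto simp: perm_mat_def)

lemma mass_perm_mat_left:
  assumes "\<forall>i<n. p i \<noteq> q i"
  shows "mass n p q (perm_mat n p) = n"
proof -
  have "mass n p q (perm_mat n p) = (\<Sum>i<n. 1)"
    unfolding mass_perm_mat using assms by (intro sum.cong) auto
  then show ?thesis by simp
qed

lemma mass_perm_mat_right:
  assumes "\<forall>i<n. p i \<noteq> q i"
  shows "mass n p q (perm_mat n q) = n"
  using mass_perm_mat_left[of n q p] assms by (metis mass_commute)

section \<open>Perfect matchings in the support of an optimal plan\<close>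

text \<open>If \<open>r\<close> left the cycle, its permutation matrix would have mass below
  \<open>n\<close>, the mass of the matrix of \<open>p\<close>; shifting a little weight from
  \<open>r\<close> to \<open>p\<close> would then increase the mass of \<open>T\<close>.\<close>

lemma opt_plan_matching_in_cycle:
  assumes cyc: "two_matching_cycle n p q" and opt: "opt_plan n p q x y T"
    and r: "bij_betw r {..<n} {..<n}" and pos: "\<And>i. i < n \<Longrightarrow> 0 < T i (r i)" and "i < n"
  shows "r i = p i \<or> r i = q i"
proof (rule ccontr)
  assume neg: "\<not> (r i = p i \<or> r i = q i)"
  define t where "t = Min ((\<lambda>i. T i (r i)) ` {..<n})"
  have t: "0 < t" "\<And>k. k < n \<Longrightarrow> t \<le> T k (r k)"
    using pos \<open>i < n\<close> unfolding t_def by (subst Min_gr_iff) auto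
  have pq: "\<forall>i<n. p i \<noteq> q i" using cyc by (simp add: two_matching_cycle_def)
  \<comment> \<open>Every summand is at most 1 because \<open>p\<close> and \<open>q\<close>
    disagree everywhere, and the summand of \<open>i\<close> is 0.\<close>
  have "mass n p q (perm_mat n r) < (\<Sum>i<n. 1)"
    unfolding mass_perm_mat
    by (rule sum_strict_mono_ex1) (use neg pq \<open>i < n\<close> in \<open>auto simp: of_bool_def intro!: bexI[of _ i]\<close>)
  then have "mass n p q (perm_mat n r) < mass n p q (perm_mat n p)"
    using mass_perm_mat_left[OF pq] by simp
  moreover have "plan n x y (\<lambda>i j. T i j + t * (perm_mat n p i j - perm_mat n r i j))"
    using t opt cyc r by (intro plan_exchange) (auto simp: opt_plan_def two_matching_cycle_def)
  then have "mass n p q T + t * (mass n p q (perm_mat n p) - mass n p q (perm_mat n r)) \<le> mass n p q T"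
    using opt unfolding opt_plan_def mass_exchange[symmetric] by blast
  ultimately show False using t by (simp add: mult_le_0_iff)
qed

text \<open>If \<open>r k = q k = p l\<close>, then injectivity forbids \<open>r l = p l\<close>,
  which leaves \<open>r l = q l\<close>. So agreement with \<open>q\<close> spreads around the whole
  cycle.\<close>

lemma cycle_perfect_matchings:
  assumes cyc: "two_matching_cycle n p q" and r: "bij_betw r {..<n} {..<n}"
    and sub: "\<And>i. i < n \<Longrightarrow> r i = p i \<or> r i = q i"
  shows "(\<forall>i<n. r i = p i) \<or> (\<forall>i<n. r i = q i)"
proof -
  let ?S = "{k. k < n \<and> r k = q k}"
  have "l \<in> ?S" if "k \<in> ?S" "l < n" "p l = q k" for k l
  proof -
    have "l \<noteq> k" using that cyc by (auto simp: two_matching_cycle_def)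
    then have "r l \<noteq> r k" using r that by (auto simp: bij_betw_def inj_on_def)
    then show ?thesis using that sub[of l] by auto
  qed
  then have "?S = {} \<or> ?S = {..<n}"
    using cyc unfolding two_matching_cycle_def by (metis (no_types, lifting) lessThan_iff mem_Collect_eq subsetI)
  then show ?thesis using sub by blast
qed

text \<open>Mass at an off-cycle position of row \<open>i\<close> can be moved along that row, from
  column \<open>q k\<close> to column \<open>p k\<close>, by exchanges that lose no cycle mass.
  Going around the cycle, such a move would finally reach column \<open>q i\<close> and gain mass,
  against optimality.\<close>

lemma opt_plan_supported_on_cycle:
  assumes cyc: "two_matching_cycle n p q" and opt: "opt_plan n p q x y T"
    and pos: "\<And>k. k < n \<Longrightarrow> 0 < T k (p k)"
    and ij: "i < n" "j < n" "j \<noteq> p i" "j \<noteq> q i"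
  shows "T i j = 0"
proof (rule ccontr)
  assume "T i j \<noteq> 0"
  then have Tij: "0 < T i j"
    using opt planD(1)[of n x y T i j] by (auto simp: opt_plan_def)
  have p: "bij_betw p {..<n} {..<n}" and q: "bij_betw q {..<n} {..<n}" and pq: "\<forall>i<n. p i \<noteq> q i"
    using cyc by (auto simp: two_matching_cycle_def)
  have pn: "p k < n" and qn: "q k < n" if "k < n" for k
    using that p q bij_betwE by blast+
  have p_inj: "p k = p l \<longleftrightarrow> k = l" if "k < n" "l < n" for k l
    using p that by (auto simp: bij_betw_def inj_on_def)
  \<comment> \<open>The off-cycle columns that carry mass in row \<open>i\<close> for some optimal
    plan positive on \<open>p\<close>; the plan may vary with the column.\<close>
  define J where "J = {j. j < n \<and> j \<noteq> p i \<and> j \<noteq> q i \<and>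
    (\<exists>T. opt_plan n p q x y T \<and> (\<forall>k<n. 0 < T k (p k)) \<and> 0 < T i j)}"
  have step: "p k \<in> J" if k: "k < n" "q k \<in> J" for k
  proof -
    obtain T where T: "opt_plan n p q x y T" "\<And>k. k < n \<Longrightarrow> 0 < T k (p k)" "0 < T i (q k)"
      and qk: "q k \<noteq> p i" "q k \<noteq> q i"
      using k(2) unfolding J_def by blast
    have ki: "k \<noteq> i" using qk by auto
    \<comment> \<open>Half of the minimum, so that the entry at \<open>(k, p k)\<close> stays
      positive and the exchange can be repeated.\<close>
    define d where "d = min (T i (q k)) (T k (p k)) / 2"
    have d: "0 < d" "d < T i (q k)" "d < T k (p k)"
      using T(2)[OF k(1)] T(3) by (auto simp: d_def min_def)
    \<comment> \<open>The product \<open>f a * g b\<close> is the rectangle exchange: it takes from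
      \<open>(i, q k)\<close> and \<open>(k, p k)\<close> and gives to \<open>(i, p k)\<close> and
      \<open>(k, q k)\<close>.\<close>
    define f :: "nat \<Rightarrow> real" where "f = (\<lambda>a. of_bool (a = k) - of_bool (a = i))"
    define g :: "nat \<Rightarrow> real" where "g = (\<lambda>b. of_bool (b = q k) - of_bool (b = p k))"
    define T' where "T' = (\<lambda>a b. T a b + d * (f a * g b))"
    have sum_f: "(\<Sum>a<n. f a) = 0"
      using k(1) ij(1) by (simp add: f_def sum_subtractf of_bool_def)
    have sum_g: "(\<Sum>b<n. g b) = 0"
      using pn[OF k(1)] qn[OF k(1)] by (simp add: g_def sum_subtractf of_bool_def)
    have pq_k: "p k \<noteq> q k" using pq k(1) by blast
    have nonneg: "0 \<le> T a b" for a b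
      using T(1) planD(1) by (auto simp: opt_plan_def)
    have plan': "plan n x y T'"
      unfolding T'_def
    proof (rule plan_perturb)
      show "plan n x y T" using T(1) by (simp add: opt_plan_def)
      show "0 \<le> T a b + d * (f a * g b)" for a b
        using d nonneg[of a b] pq_k ki by (auto simp: f_def g_def of_bool_def)
      show "d * (f a * g b) = 0" if "\<not> (a < n \<and> b < n)" for a b
        using that k(1) ij(1) pn qn by (auto simp: f_def g_def of_bool_def)
      show "(\<Sum>b<n. d * (f a * g b)) = 0" for a
        by (simp add: sum_distrib_left[symmetric] sum_g)
      show "(\<Sum>a<n. d * (f a * g b)) = 0" for b
        by (simp add: sum_distrib_left[symmetric] sum_distrib_right[symmetric] sum_f)
    qed
    have "mass n p q T' = mass n p q T + d * (\<Sum>a<n. f a * (g (p a) + g (q a)))"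
      by (simp add: mass_def T'_def sum.distrib sum_distrib_left algebra_simps)
    also have "(\<Sum>a<n. f a * (g (p a) + g (q a))) = (g (p k) + g (q k)) - (g (p i) + g (q i))"
      using k(1) ij(1) by (simp add: f_def left_diff_distrib sum_subtractf of_bool_def if_distrib[of "\<lambda>c. c * _"] cong: if_cong)
    \<comment> \<open>In row \<open>k\<close> the loss on \<open>p\<close> and the gain on
      \<open>q\<close> cancel. In row \<open>i\<close> the receiving position
      \<open>(i, p k)\<close> can lie on the cycle only as the edge of \<open>q\<close>.\<close>
    also have "\<dots> = of_bool (q i = p k)"
      using qk pq_k ki p_inj[OF ij(1) k(1)] by (auto simp: g_def of_bool_def)
    finally have mass': "mass n p q T' = mass n p q T + d * of_bool (q i = p k)" .
    moreover have "mass n p q T' \<le> mass n p q T"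
      using T(1) plan' by (auto simp: opt_plan_def)
    ultimately have qipk: "q i \<noteq> p k" using d(1) by auto
    have "opt_plan n p q x y T'"
      using T(1) plan' mass' qipk by (simp add: opt_plan_def)
    moreover have "0 < T' l (p l)" if "l < n" for l
      using T(2)[OF that] d qk pq_k ki p_inj[OF that k(1)] p_inj[OF ij(1) k(1)]
      by (auto simp: T'_def f_def g_def of_bool_def)
    moreover have "0 < T' i (p k)"
      using nonneg[of i "p k"] d ki pq_k by (auto simp: T'_def f_def g_def of_bool_def)
    ultimately show ?thesis
      using pn[OF k(1)] qipk ki p_inj[OF k(1) ij(1)] by (auto simp: J_def)
  qed
  have "j \<in> J" using ij Tij opt pos by (auto simp: J_def)
  moreover obtain k where "k < n" "q k = j"
    using q ij(2) by (metis bij_betw_def imageE lessThan_iff)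
  ultimately have "{k. k < n \<and> q k \<in> J} \<noteq> {}" by blast
  moreover have "\<forall>k\<in>{k. k < n \<and> q k \<in> J}. \<forall>l<n. q l = p k \<longrightarrow> l \<in> {k. k < n \<and> q k \<in> J}"
    using step by auto
  \<comment> \<open>By \<open>step\<close> this set of rows is closed under \<open>q^-1 p\<close>,
    so it contains \<open>i\<close>; but \<open>J\<close> excludes the column
    \<open>q i\<close>.\<close>
  ultimately have "{k. k < n \<and> q k \<in> J} = {..<n}"
    using two_matching_cycle_commute[OF cyc] unfolding two_matching_cycle_def
    by (metis (no_types, lifting) lessThan_iff mem_Collect_eq subsetI)
  then have "q i \<in> J" using ij(1) by auto
  then show False by (simp add: J_def)
qed

text \<open>The difference of the plans has zero row and column sums, and each row or column meets
  the cycle in two edges. Hence it alternates in sign along the cycle and is constant on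
  \<open>p\<close>.\<close>

lemma plans_on_cycle_differ_by_constant:
  assumes cyc: "two_matching_cycle n p q" and T: "plan n x y T" and U: "plan n x y U"
    and supT: "\<And>i j. i < n \<Longrightarrow> j < n \<Longrightarrow> j \<noteq> p i \<Longrightarrow> j \<noteq> q i \<Longrightarrow> T i j = 0"
    and supU: "\<And>i j. i < n \<Longrightarrow> j < n \<Longrightarrow> j \<noteq> p i \<Longrightarrow> j \<noteq> q i \<Longrightarrow> U i j = 0"
  shows "\<exists>t. \<forall>k<n. T k (p k) = U k (p k) + t"
proof (cases "n = 0")
  case False
  have p: "bij_betw p {..<n} {..<n}" and q: "bij_betw q {..<n} {..<n}" and pq: "\<forall>i<n. p i \<noteq> q i"
    using cyc by (auto simp: two_matching_cycle_def)
  have pn: "p k < n" and qn: "q k < n" if "k < n" for k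
    using that p q bij_betwE by blast+
  define D where "D = (\<lambda>i j. T i j - U i j)"
  have row: "D i (p i) + D i (q i) = 0" if "i < n" for i
  proof -
    have "(\<Sum>j<n. D i j) = (\<Sum>j\<in>{p i, q i}. D i j)"
      using that pn qn supT supU by (intro sum.mono_neutral_right) (auto simp: D_def)
    moreover have "(\<Sum>j<n. D i j) = 0"
      using that T U by (simp add: D_def sum_subtractf plan_def)
    ultimately show ?thesis using pq that by simp
  qed
  have col: "D k (q k) + D l (p l) = 0" if "k < n" "l < n" "p l = q k" for k l
  proof -
    have "(\<Sum>i<n. D i (q k)) = (\<Sum>i\<in>{k, l}. D i (q k))"
    proof (rule sum.mono_neutral_right)
      show "\<forall>i\<in>{..<n} - {k, l}. D i (q k) = 0"
      proof
        fix i assume i: "i \<in> {..<n} - {k, l}"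
        then have "q k \<noteq> q i" using q that by (auto simp: bij_betw_def inj_on_def)
        moreover have "q k \<noteq> p i" using p that i by (metis DiffD1 DiffD2 bij_betw_def inj_on_def insertCI lessThan_iff)
        ultimately show "D i (q k) = 0" using i qn that supT supU by (auto simp: D_def)
      qed
    qed (use that in auto)
    moreover have "(\<Sum>i<n. D i (q k)) = 0"
      using that T U qn by (simp add: D_def sum_subtractf plan_def)
    moreover have "k \<noteq> l" using pq that by auto
    ultimately show ?thesis using that by simp
  qed
  let ?S = "{k. k < n \<and> D k (p k) = D 0 (p 0)}"
  have "\<forall>k\<in>?S. \<forall>l<n. p l = q k \<longrightarrow> l \<in> ?S"
  proof (intro ballI allI impI)
    fix k l assume "k \<in> ?S" "l < n" "p l = q k"
    then show "l \<in> ?S" using col[of k l] row[of k] by auto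
  qed
  moreover have "?S \<noteq> {}" using False by auto
  ultimately have "?S = {..<n}"
    using cyc unfolding two_matching_cycle_def
    by (metis (no_types, lifting) lessThan_iff mem_Collect_eq subsetI)
  then have "\<forall>k<n. T k (p k) = U k (p k) + D 0 (p 0)"
    by (auto simp: D_def algebra_simps)
  then show ?thesis by blast
qed auto

section \<open>Matchings that involve both kinds of agents\<close>

lemma plan_max_pos:
  assumes "plan n x y T" "(\<Sum>i<n. x i) = 1" "\<And>a b. a < n \<Longrightarrow> b < n \<Longrightarrow> T a b \<le> c"
  shows "0 < c"
proof (rule ccontr)
  assume "\<not> 0 < c"
  then have "T a b \<le> 0" if "a < n" "b < n" for a b
    using assms(3)[OF that] by linarith
  then have "(\<Sum>a<n. \<Sum>b<n. T a b) \<le> 0"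
    by (intro sum_nonpos) auto
  then show False
    using assms(1,2) by (simp add: plan_def)
qed

lemma no_mixed_matching_on_first:
  assumes cyc: "two_matching_cycle n p q"
    and opt: "\<And>i. i < n \<Longrightarrow> opt_plan n p q x y (T i)"
    and max: "\<And>i a b. i < n \<Longrightarrow> a < n \<Longrightarrow> b < n \<Longrightarrow> T i a b \<le> T i i (p i)"
    and pos: "\<And>i. i < n \<Longrightarrow> 0 < T i i (p i)"
    and van: "\<And>i. i < n \<Longrightarrow> i \<notin> A \<Longrightarrow> \<exists>k<n. T i k (p k) = 0"
    and b: "b < n" "b \<notin> A"
  shows False
proof -
  have p: "bij_betw p {..<n} {..<n}" using cyc by (simp add: two_matching_cycle_def)
  have pn: "p k < n" if "k < n" for k
    using that p bij_betwE by blast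
  have plans: "plan n x y (T i)" if "i < n" for i
    using opt[OF that] by (simp add: opt_plan_def)
  have nonneg: "0 \<le> T i a c" if "i < n" for i a c
    using planD(1)[OF plans[OF that]] .
  \<comment> \<open>Each \<open>T m\<close> is only known to be positive at its own edge of
    \<open>p\<close>. The average is positive on all of \<open>p\<close>, and its zeros are common
    zeros of all \<open>T m\<close>.\<close>
  let ?U = "\<lambda>i j. (\<Sum>m<n. T m i j) / n"
  have U: "opt_plan n p q x y ?U"
    using opt b(1) by (intro opt_plan_average) auto
  have "0 < (\<Sum>m<n. T m k (p k))" if "k < n" for k
    using that nonneg pos by (intro sum_pos2[of _ k]) auto
  then have "0 < ?U k (p k)" if "k < n" for k
    using that by simp
  then have "?U i j = 0" if "i < n" "j < n" "j \<noteq> p i" "j \<noteq> q i" for i j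
    using opt_plan_supported_on_cycle[OF cyc U _ that] by blast
  then have "(\<Sum>m<n. T m i j) = 0" if "i < n" "j < n" "j \<noteq> p i" "j \<noteq> q i" for i j
    using that by force
  then have sup: "T m i j = 0" if "m < n" "i < n" "j < n" "j \<noteq> p i" "j \<noteq> q i" for m i j
    using that nonneg by (subst (asm) sum_nonneg_eq_0_iff) auto
  obtain k where k: "k < n" "T b k (p k) = 0" using van b by blast
  obtain t where t: "\<And>l. l < n \<Longrightarrow> T k l (p l) = T b l (p l) + t"
    using plans_on_cycle_differ_by_constant[OF cyc plans[OF k(1)] plans[OF b(1)]] sup k(1) b(1) by blast
  have tk: "t = T k k (p k)" using t[OF k(1)] k(2) by simp
  show False
  proof (cases "k \<in> A")
    case True
    \<comment> \<open>Along \<open>p\<close> the plan \<open>T k\<close> is \<open>T b\<close>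
      shifted up by its own maximum \<open>t\<close>, so \<open>T b\<close> could not be positive at
      \<open>(b, p b)\<close>.\<close>
    have "T k b (p b) \<le> T k k (p k)" using max k(1) b(1) pn by blast
    then show False using t[OF b(1)] tk pos[OF b(1)] by simp
  next
    case False
    \<comment> \<open>Now \<open>T k\<close> vanishes somewhere on \<open>p\<close>, although it is
      at least \<open>t > 0\<close> there.\<close>
    then obtain l where "l < n" "T k l (p l) = 0" using van k(1) by blast
    then show False using t[of l] tk pos[OF k(1)] nonneg[OF b(1), of l "p l"] by simp
  qed
qed

lemma no_mixed_matching:
  assumes cyc: "two_matching_cycle n p q" and x: "(\<Sum>i<n. x i) = 1"
    and r: "bij_betw r {..<n} {..<n}"
    and opt: "\<And>i. i < n \<Longrightarrow> opt_plan n p q x y (T i)"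
    and max: "\<And>i a b. i < n \<Longrightarrow> a < n \<Longrightarrow> b < n \<Longrightarrow> T i a b \<le> T i i (r i)"
    and vanA: "\<And>i. i < n \<Longrightarrow> i \<in> A \<Longrightarrow> \<exists>k<n. T i k (q k) = 0"
    and vanB: "\<And>i. i < n \<Longrightarrow> i \<notin> A \<Longrightarrow> \<exists>k<n. T i k (p k) = 0"
    and a: "a < n" "a \<in> A" and b: "b < n" "b \<notin> A"
  shows False
proof -
  have pos: "0 < T i i (r i)" if "i < n" for i
    using opt[OF that] x max[OF that] by (intro plan_max_pos[of n x y "T i"]) (auto simp: opt_plan_def)
  let ?U = "\<lambda>i j. (\<Sum>m<n. T m i j) / n"
  have U: "opt_plan n p q x y ?U"
    using opt b(1) by (intro opt_plan_average) auto
  have "0 < (\<Sum>m<n. T m k (r k))" if "k < n" for k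
    using that pos opt by (intro sum_pos2[of _ k]) (auto simp: opt_plan_def plan_def)
  then have "0 < ?U k (r k)" if "k < n" for k
    using that by simp
  then have "r i = p i \<or> r i = q i" if "i < n" for i
    using opt_plan_matching_in_cycle[OF cyc U r _ that] by blast
  then consider "\<forall>i<n. r i = p i" | "\<forall>i<n. r i = q i"
    using cycle_perfect_matchings[OF cyc r] by blast
  then show False
  proof cases
    case 1
    then show False
      using no_mixed_matching_on_first[OF cyc, where T = T and A = A and b = b] opt max pos vanB b by auto
  next
    case 2
    \<comment> \<open>Exchanging \<open>p\<close> and \<open>q\<close> exchanges the kinds:
      \<open>- A\<close> and \<open>a\<close> take over from \<open>A\<close> and
      \<open>b\<close>.\<close>
    have "opt_plan n q p x y (T i)" if "i < n" for i
      using opt[OF that] by (simp add: opt_plan_commute[of n q p])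
    then show False
      using no_mixed_matching_on_first[OF two_matching_cycle_commute[OF cyc], where T = T and A = "- A" and b = a]
        2 max pos vanA a by auto
  qed
qed

section \<open>Optimal plans depend on the marginals in a closed way\<close>

lemma divisions_pairD:
  assumes "P \<in> divisions [n, n]" "0 < n" "t < 2"
  shows "0 \<le> P t i" "P t i \<le> 1" "(\<Sum>i<n. P t i) = 1"
proof -
  have "[n, n] ! t = n" using assms(3) by (cases t) auto
  then have *: "P t \<in> standard_simplex (n - 1)"
    using PiE_mem[OF assms(1)[unfolded divisions_def], of t] assms(3) by simp
  then show "0 \<le> P t i" "P t i \<le> 1" by (auto simp: standard_simplex_def)
  have "{..n - 1} = {..<n}" using assms(2) by auto
  then show "(\<Sum>i<n. P t i) = 1" using * by (simp add: standard_simplex_def)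
qed

text \<open>The marginals left over after placing \<open>c * T0\<close> are nonnegative with total
  \<open>1 - c\<close>, so they have a plan of their own, which is added.\<close>

lemma plan_extend_scaled:
  assumes P: "P \<in> divisions [n, n]" and P0: "P0 \<in> divisions [n, n]" and n: "0 < n"
    and c: "0 \<le> c" "c < 1" and T0: "plan n (P0 0) (P0 1) T0"
    and le: "\<And>t i. t < 2 \<Longrightarrow> i < n \<Longrightarrow> c * P0 t i \<le> P t i"
  shows "\<exists>T. plan n (P 0) (P 1) T \<and> (\<forall>i j. c * T0 i j \<le> T i j)"
proof -
  have sum: "(\<Sum>i<n. P t i - c * P0 t i) = 1 - c" if "t < 2" for t
    using divisions_pairD(3)[OF P n that] divisions_pairD(3)[OF P0 n that]
    by (simp add: sum_subtractf sum_distrib_left[symmetric])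
  obtain R where R: "plan n (\<lambda>i. P 0 i - c * P0 0 i) (\<lambda>i. P 1 i - c * P0 1 i) R"
    using plan_exists[of n "\<lambda>i. P 0 i - c * P0 0 i" "\<lambda>i. P 1 i - c * P0 1 i" "1 - c"]
      sum[of 0] sum[of 1] le c by auto
  let ?T = "\<lambda>i j. c * T0 i j + R i j"
  have "plan n (P 0) (P 1) ?T"
    using T0 R c(1) by (auto simp: plan_def sum.distrib sum_distrib_left[symmetric])
  moreover have "\<forall>i j. c * T0 i j \<le> ?T i j"
    using planD(1)[OF R] by simp
  ultimately show ?thesis by blast
qed

text \<open>The point of this reformulation is that, for fixed \<open>c\<close>, \<open>P0\<close> and \<open>T0\<close>, the premise is open and the conclusion
  is closed in \<open>(P, T)\<close>.\<close>

lemma opt_plan_iff_dominates_scaled: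
  assumes P: "P \<in> divisions [n, n]" and n: "0 < n"
  shows "opt_plan n p q (P 0) (P 1) T \<longleftrightarrow> plan n (P 0) (P 1) T \<and>
    (\<forall>c P0 T0. 0 \<le> c \<and> c < 1 \<and> P0 \<in> divisions [n, n] \<and> plan n (P0 0) (P0 1) T0 \<longrightarrow>
      (\<forall>t<2. \<forall>i<n. P0 t i \<le> 0 \<or> c * P0 t i < P t i) \<longrightarrow> c * mass n p q T0 \<le> mass n p q T)"
  (is "?L \<longleftrightarrow> ?R")
proof
  assume L: ?L
  show ?R
  proof (intro conjI allI impI)
    show "plan n (P 0) (P 1) T" using L by (simp add: opt_plan_def)
    fix c P0 T0
    assume A: "0 \<le> c \<and> c < 1 \<and> P0 \<in> divisions [n, n] \<and> plan n (P0 0) (P0 1) T0"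
      and le: "\<forall>t<2. \<forall>i<n. P0 t i \<le> 0 \<or> c * P0 t i < P t i"
    have "c * P0 t i \<le> P t i" if "t < 2" "i < n" for t i
    proof (cases "P0 t i \<le> 0")
      case True
      then have "P0 t i = 0" using A divisions_pairD(1)[of P0 n t i] n that by auto
      then show ?thesis using divisions_pairD(1)[OF P n that(1)] by simp
    next
      case False
      then show ?thesis using le that by force
    qed
    then obtain T' where T': "plan n (P 0) (P 1) T'" "\<forall>i j. c * T0 i j \<le> T' i j"
      using plan_extend_scaled[OF P _ n, of P0 c T0] A by blast
    have "c * mass n p q T0 \<le> mass n p q T'"
      unfolding mass_def sum_distrib_left distrib_left
      using T'(2) by (intro sum_mono add_mono) auto
    then show "c * mass n p q T0 \<le> mass n p q T"
      using L T'(1) unfolding opt_plan_def by force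
  qed
next
  assume R: ?R
  have "mass n p q T' \<le> mass n p q T" if T': "plan n (P 0) (P 1) T'" for T'
  proof (rule field_le_mult_one_interval)
    fix c :: real assume c: "0 < c" "c < 1"
    \<comment> \<open>With \<open>P0 = P\<close> the premise holds for every \<open>c < 1\<close>,
      the first disjunct covering the slices of length 0; then \<open>c\<close> tends to 1.\<close>
    have "\<forall>t<2. \<forall>i<n. P t i \<le> 0 \<or> c * P t i < P t i"
      using c by (auto simp: mult_less_cancel_right2)
    then show "c * mass n p q T' \<le> mass n p q T"
      using R P T' c by force
  qed
  then show ?L using R by (simp add: opt_plan_def)
qed

section \<open>Compactness and closed projections\<close>

lemma compact_unit_matrices: "compact {T :: nat \<Rightarrow> nat \<Rightarrow> real. \<forall>i j. 0 \<le> T i j \<and> T i j \<le> 1}"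
proof -
  have "compactin (product_topology (\<lambda>_. euclidean) UNIV) (\<Pi>\<^sub>E i\<in>(UNIV::nat set). {0..1::real})"
    by (subst compactin_PiE) auto
  then have "compact (\<Pi>\<^sub>E i\<in>(UNIV::nat set). {0..1::real})"
    by (simp add: euclidean_product_topology)
  then have "compactin (product_topology (\<lambda>_. euclidean) UNIV)
      (\<Pi>\<^sub>E i\<in>(UNIV::nat set). \<Pi>\<^sub>E j\<in>(UNIV::nat set). {0..1::real})"
    by (subst compactin_PiE) auto
  moreover have "{T :: nat \<Rightarrow> nat \<Rightarrow> real. \<forall>i j. 0 \<le> T i j \<and> T i j \<le> 1} =
      (\<Pi>\<^sub>E i\<in>(UNIV::nat set). \<Pi>\<^sub>E j\<in>(UNIV::nat set). {0..1::real})"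
    by (auto simp: PiE_iff)
  ultimately show ?thesis by (simp add: euclidean_product_topology)
qed

text \<open>The tube lemma; it eliminates the existentially quantified plan in
  \<open>labels\<close>.\<close>

lemma closed_projection_along_compact:
  fixes U :: "('a::topological_space \<times> 'b::topological_space) set"
  assumes "compact K" "closed U"
  shows "closed {x. \<exists>y\<in>K. (x, y) \<in> U}"
proof -
  have "closed_map (prod_topology euclidean (top_of_set K)) (euclidean :: 'a topology) fst"
    using assms(1) by (intro Abstract_Topological_Spaces.closed_map_fst) (simp add: compact_space_subtopology)
  moreover have "closedin (prod_topology (euclidean :: 'a topology) (top_of_set K)) (U \<inter> UNIV \<times> K)"
  proof -
    have "prod_topology (euclidean :: 'a topology) (top_of_set K) = top_of_set (UNIV \<times> K)"
      using prod_topology_subtopology_eu[of "UNIV :: 'a set" K] by simp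
    then show ?thesis using closedin_closed_Int[OF assms(2), of "UNIV \<times> K"] by (simp add: Int_commute)
  qed
  ultimately have "closed (fst ` (U \<inter> UNIV \<times> K))"
    unfolding closed_map_def closed_closedin by blast
  moreover have "fst ` (U \<inter> UNIV \<times> K) = {x. \<exists>y\<in>K. (x, y) \<in> U}"
    by force
  ultimately show ?thesis by simp
qed

section \<open>The preferences\<close>

text \<open>The optimal plans of a division can form a segment in direction \<open>p - q\<close>; vanishing at an edge of
  \<open>q\<close> singles out one of its end points by a closed condition.\<close>

definition labels ::
  "nat \<Rightarrow> (nat \<Rightarrow> nat) \<Rightarrow> (nat \<Rightarrow> nat) \<Rightarrow> (nat \<Rightarrow> nat \<Rightarrow> real) \<Rightarrow> (nat \<Rightarrow> nat) set" where
  "labels n p q P = {j \<in> slice_tuples [n, n]. \<exists>T. opt_plan n p q (P 0) (P 1) T \<and>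
     (\<exists>k<n. T k (q k) = 0) \<and> (\<forall>a<n. \<forall>b<n. T a b \<le> T (j 0) (j 1))}"

lemma plan_in_unit_matrices:
  assumes "plan n (P 0) (P 1) T" "P \<in> divisions [n, n]" "0 < n"
  shows "0 \<le> T i j \<and> T i j \<le> 1"
proof (cases "i < n \<and> j < n")
  case True
  then show ?thesis
    using plan_le_row[OF assms(1), of i j] divisions_pairD(2)[OF assms(2,3), of 0 i] planD(1)[OF assms(1)] by force
next
  case False
  then show ?thesis using planD(2)[OF assms(1)] by simp
qed

lemma continuous_on_matrix_entry:
  "continuous_on S (\<lambda>T :: nat \<Rightarrow> nat \<Rightarrow> real. T i j)"
  using continuous_on_product_then_coordinatewise[OF
      continuous_on_product_then_coordinatewise[OF continuous_on_id]] .

lemma continuous_on_fst_entry: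
  "continuous_on S (\<lambda>z :: (nat \<Rightarrow> nat \<Rightarrow> real) \<times> 'b::topological_space. fst z i j)"
  using continuous_on_product_then_coordinatewise[OF
      continuous_on_product_then_coordinatewise[OF continuous_on_fst[OF continuous_on_id]]] .

lemma continuous_on_snd_entry:
  "continuous_on S (\<lambda>z :: 'b::topological_space \<times> (nat \<Rightarrow> nat \<Rightarrow> real). snd z i j)"
  using continuous_on_product_then_coordinatewise[OF
      continuous_on_product_then_coordinatewise[OF continuous_on_snd[OF continuous_on_id]]] .

lemmas entry_intros = continuous_on_matrix_entry continuous_on_fst_entry continuous_on_snd_entry
  continuous_on_add continuous_on_sum continuous_on_const

lemma closed_Collect_plan: "closed {z. plan n ((fst z :: nat \<Rightarrow> nat \<Rightarrow> real) 0) (fst z 1) (snd z)}"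
  unfolding plan_def
  by (intro closed_Collect_conj closed_Collect_all closed_Collect_imp open_Collect_const
      closed_Collect_le closed_Collect_eq entry_intros)

lemma open_Collect_all_less:
  assumes "\<And>i. i < (n::nat) \<Longrightarrow> open {z. Q i z}"
  shows "open {z. \<forall>i<n. Q i z}"
proof -
  have "{z. \<forall>i<n. Q i z} = (\<Inter>i\<in>{..<n}. {z. Q i z})" by auto
  then show ?thesis using assms by (auto intro!: open_INT)
qed

lemma closed_Collect_ex_less:
  assumes "\<And>i. i < (n::nat) \<Longrightarrow> closed {z. Q i z}"
  shows "closed {z. \<exists>i<n. Q i z}"
proof -
  have "{z. \<exists>i<n. Q i z} = (\<Union>i\<in>{..<n}. {z. Q i z})" by auto
  then show ?thesis using assms by (auto intro!: closed_UN)
qed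

lemma closedin_labels:
  assumes n: "0 < n" and j: "j \<in> slice_tuples [n, n]"
  shows "closedin (top_of_set (divisions [n, n])) {P \<in> divisions [n, n]. j \<in> labels n p q P}"
proof -
  define K where "K = {T :: nat \<Rightarrow> nat \<Rightarrow> real. \<forall>i j. 0 \<le> T i j \<and> T i j \<le> 1}"
  \<comment> \<open>Optimality is written in its reformulated form, so that \<open>U\<close> is
    closed in the whole space; the agreement with \<open>opt_plan\<close> is claimed only over
    divisions.\<close>
  define U where "U = {z. (plan n (fst z 0) (fst z 1) (snd z) \<and>
    (\<forall>c P0 T0. 0 \<le> c \<and> c < 1 \<and> P0 \<in> divisions [n, n] \<and> plan n (P0 0) (P0 1) T0 \<longrightarrow>
      (\<forall>t<2. \<forall>i<n. P0 t i \<le> 0 \<or> c * P0 t i < fst z t i) \<longrightarrow> c * mass n p q T0 \<le> mass n p q (snd z))) \<and>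
    (\<exists>k<n. snd z k (q k) = 0) \<and> (\<forall>a<n. \<forall>b<n. snd z a b \<le> snd z (j 0) (j 1))}"
  have "closed U"
    unfolding U_def mass_def
    by (intro closed_Collect_conj closed_Collect_all closed_Collect_imp open_Collect_const closed_Collect_plan
        closed_Collect_ex_less open_Collect_all_less open_Collect_disj open_Collect_less
        closed_Collect_le closed_Collect_eq entry_intros)
  then have "closed {P. \<exists>T\<in>K. (P, T) \<in> U}"
    using compact_unit_matrices unfolding K_def by (rule closed_projection_along_compact[rotated])
  moreover have "{P \<in> divisions [n, n]. j \<in> labels n p q P} = divisions [n, n] \<inter> {P. \<exists>T\<in>K. (P, T) \<in> U}"
  proof -
    have "(\<exists>T\<in>K. (P, T) \<in> U) \<longleftrightarrow> j \<in> labels n p q P" if P: "P \<in> divisions [n, n]" for P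
    proof -
      have "(P, T) \<in> U \<longleftrightarrow> opt_plan n p q (P 0) (P 1) T \<and>
         (\<exists>k<n. T k (q k) = 0) \<and> (\<forall>a<n. \<forall>b<n. T a b \<le> T (j 0) (j 1))" for T
        unfolding opt_plan_iff_dominates_scaled[OF P n] U_def by simp
      moreover have "T \<in> K" if "opt_plan n p q (P 0) (P 1) T" for T
        using that plan_in_unit_matrices[OF _ P n] by (simp add: K_def opt_plan_def)
      ultimately show ?thesis using j by (auto simp: labels_def)
    qed
    then show ?thesis by auto
  qed
  ultimately show ?thesis by (simp add: closedin_closed_Int)
qed

lemma opt_plan_exists:
  assumes P: "P \<in> divisions [n, n]" and n: "0 < n"
  shows "\<exists>T. opt_plan n p q (P 0) (P 1) T"
proof -
  let ?S = "{T. plan n (P 0) (P 1) T}"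
  have "closed (Pair P -` {z. plan n ((fst z :: nat \<Rightarrow> nat \<Rightarrow> real) 0) (fst z 1) (snd z)})"
    by (intro closed_vimage closed_Collect_plan continuous_on_Pair continuous_on_const continuous_on_id)
  then have clo: "closed ?S" by (simp add: vimage_def)
  have "{T. \<forall>i j. 0 \<le> T i j \<and> T i j \<le> 1} \<inter> ?S = ?S"
    using plan_in_unit_matrices[OF _ P n] by (intro Int_absorb1 subsetI) simp
  then have "compact ?S"
    using compact_Int_closed[OF compact_unit_matrices clo] by simp
  moreover have "?S \<noteq> {}"
    using plan_exists[of n "P 0" "P 1" 1] divisions_pairD[OF P n] by auto
  moreover have "continuous_on ?S (\<lambda>T. mass n p q T)"
    unfolding mass_def by (intro continuous_on_sum continuous_on_add continuous_on_matrix_entry)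
  ultimately obtain T where "T \<in> ?S" "\<forall>T'\<in>?S. mass n p q T' \<le> mass n p q T"
    using continuous_attains_sup by blast
  then show ?thesis by (auto simp: opt_plan_def)
qed

text \<open>Moving weight from \<open>q\<close> to \<open>p\<close> keeps an optimal plan optimal,
  since both matrices have mass \<open>n\<close>; it is moved until an edge of \<open>q\<close>
  becomes empty. A largest entry of the result is positive and bounded by both slice
  lengths.\<close>

lemma labels_positive:
  assumes P: "P \<in> divisions [n, n]" and n: "0 < n" and cyc: "two_matching_cycle n p q"
  shows "\<exists>j\<in>labels n p q P. \<forall>t<2. 0 < P t (j t)"
proof -
  have p: "bij_betw p {..<n} {..<n}" and q: "bij_betw q {..<n} {..<n}" and pq: "\<forall>i<n. p i \<noteq> q i"
    using cyc by (auto simp: two_matching_cycle_def)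
  obtain T0 where T0: "opt_plan n p q (P 0) (P 1) T0" using opt_plan_exists[OF P n] by blast
  define t where "t = Min ((\<lambda>k. T0 k (q k)) ` {..<n})"
  have "t \<in> (\<lambda>k. T0 k (q k)) ` {..<n}"
    unfolding t_def using n by (intro Min_in) auto
  then obtain k where k: "k < n" "t = T0 k (q k)" by auto
  have t_le: "t \<le> T0 k (q k)" if "k < n" for k
    unfolding t_def using that by (intro Min_le) auto
  have "0 \<le> t" using k T0 planD(1) by (auto simp: opt_plan_def)
  define T where "T = (\<lambda>i j. T0 i j + t * (perm_mat n p i j - perm_mat n q i j))"
  have plan: "plan n (P 0) (P 1) T"
    unfolding T_def using T0 p q \<open>0 \<le> t\<close> t_le by (intro plan_exchange) (auto simp: opt_plan_def)
  have "mass n p q T = mass n p q T0"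
    unfolding T_def mass_exchange using mass_perm_mat_left[OF pq] mass_perm_mat_right[OF pq] by simp
  then have opt: "opt_plan n p q (P 0) (P 1) T"
    using plan T0 by (simp add: opt_plan_def)
  have zero: "T k (q k) = 0"
    using k pq by (auto simp: T_def perm_mat_def)
  let ?E = "{..<n} \<times> {..<n}"
  have "Max ((\<lambda>(a, b). T a b) ` ?E) \<in> (\<lambda>(a, b). T a b) ` ?E"
    using n by (intro Max_in) auto
  then obtain a b where ab: "a < n" "b < n" "T a b = Max ((\<lambda>(a, b). T a b) ` ?E)" by auto
  have max: "T a' b' \<le> T a b" if "a' < n" "b' < n" for a' b'
    unfolding ab(3) using that by (intro Max_ge) auto
  have pos: "0 < T a b"
    using plan_max_pos[OF plan _ max] divisions_pairD(3)[OF P n, of 0] by simp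
  \<comment> \<open>The value \<open>undefined\<close> beyond the two cakes is required by the
    extensional product.\<close>
  define j :: "nat \<Rightarrow> nat" where "j = (\<lambda>t. if t = 0 then a else if t = 1 then b else undefined)"
  have "j \<in> slice_tuples [n, n]"
    using ab by (auto simp: slice_tuples_def j_def PiE_iff extensional_def less_Suc_eq)
  then have "j \<in> labels n p q P"
    using opt zero k(1) max by (auto simp: labels_def j_def)
  moreover have "0 < P t (j t)" if "t < 2" for t
  proof -
    have "t = 0 \<or> t = 1" using that by auto
    then show ?thesis
      using pos plan_le_row[OF plan ab(1,2)] plan_le_col[OF plan ab(1,2)] by (auto simp: j_def)
  qed
  ultimately show ?thesis by blast
qed

section \<open>A concrete cycle and the final count\<close>

lemma two_matching_cycle_successor:
  assumes "n \<ge> 2"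
  shows "two_matching_cycle n (\<lambda>i. i) (\<lambda>i. if Suc i = n then 0 else Suc i)" (is "two_matching_cycle n _ ?s")
  unfolding two_matching_cycle_def
proof (intro conjI allI impI)
  show "bij_betw (\<lambda>i. i) {..<n} {..<n}" by (simp add: bij_betw_def)
  have "inj_on ?s {..<n}" by (auto simp: inj_on_def split: if_splits)
  moreover have "?s ` {..<n} \<subseteq> {..<n}" using assms by auto
  ultimately show "bij_betw ?s {..<n} {..<n}"
    unfolding bij_betw_def using endo_inj_surj[of "{..<n}" ?s] by blast
  show "i \<noteq> ?s i" for i using assms by auto
next
  fix S assume S: "S \<subseteq> {..<n}" "S \<noteq> {}" and cl: "\<forall>k\<in>S. \<forall>l<n. l = ?s k \<longrightarrow> l \<in> S"
  have step: "?s k \<in> S" if "k \<in> S" for k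
  proof -
    have "?s k < n" using that S(1) by (auto simp: subset_iff Suc_lessI)
    then show ?thesis using cl that by blast
  qed
  obtain k where k: "k \<in> S" using S by blast
  \<comment> \<open>Climb from \<open>k\<close> to \<open>n - 1\<close>, wrap around to 0, and climb
    again through all indices.\<close>
  have "k + m < n \<Longrightarrow> k + m \<in> S" for m
  proof (induction m)
    case (Suc m)
    then show ?case using step[of "k + m"] by (auto split: if_splits)
  qed (use k in simp)
  from this[of "n - 1 - k"] have "n - 1 \<in> S" using k S by force
  then have "0 \<in> S" using step[of "n - 1"] assms by simp
  have "m < n \<Longrightarrow> m \<in> S" for m
  proof (induction m)
    case (Suc m)
    then show ?case using step[of m] by (auto split: if_splits)
  qed (use \<open>0 \<in> S\<close> in simp)
  then show "S = {..<n}" using S by auto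
qed

text \<open>At least \<open>n\<close> matched agents would use each slice of each cake exactly once,
  so their pairs would be the graph of a permutation, and \<open>no_mixed_matching\<close>
  applies.\<close>

lemma ad_matching_labels_card:
  assumes n: "n \<ge> 2" and cyc: "two_matching_cycle n p q" and P: "P \<in> divisions [n, n]"
    and match: "ad_matching (2 * n - 2) [n, n] (\<lambda>i. if i < n - 1 then labels n p q else labels n q p) P Q \<phi>"
  shows "card Q < n"
proof (rule ccontr)
  assume "\<not> card Q < n"
  have Q: "Q \<subseteq> {..<2 * n - 2}"
    and lab: "\<And>i. i \<in> Q \<Longrightarrow> \<phi> i \<in> (if i < n - 1 then labels n p q P else labels n q p P)"
    and dist: "\<And>i i' t. i \<in> Q \<Longrightarrow> i' \<in> Q \<Longrightarrow> i \<noteq> i' \<Longrightarrow> t < 2 \<Longrightarrow> \<phi> i t \<noteq> \<phi> i' t"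
    using match by (auto simp: ad_matching_def split: if_splits)
  have range: "\<phi> i t < n" if "i \<in> Q" "t < 2" for i t
  proof -
    have *: "\<phi> i \<in> slice_tuples [n, n]" using lab[OF that(1)] by (auto simp: labels_def split: if_splits)
    have "[n, n] ! t = n" using that(2) by (cases t) auto
    then show ?thesis
      using PiE_mem[OF *[unfolded slice_tuples_def], of t] that(2) by simp
  qed
  have inj: "inj_on (\<lambda>i. \<phi> i t) Q" if "t < 2" for t
    using dist that by (auto simp: inj_on_def)
  have bij: "bij_betw (\<lambda>i. \<phi> i t) Q {..<n}" if "t < 2" for t
  proof -
    have "(\<lambda>i. \<phi> i t) ` Q \<subseteq> {..<n}" using range that by auto
    moreover have "card ((\<lambda>i. \<phi> i t) ` Q) \<ge> card {..<n}"
      using card_image[OF inj[OF that]] \<open>\<not> card Q < n\<close> by simp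
    ultimately have "(\<lambda>i. \<phi> i t) ` Q = {..<n}" by (intro card_seteq) auto
    then show ?thesis using inj[OF that] by (simp add: bij_betw_def)
  qed
  \<comment> \<open>Agents are reindexed by their slice of the first cake; \<open>A\<close> below
    collects the slices held by the first kind.\<close>
  define g where "g = inv_into Q (\<lambda>i. \<phi> i 0)"
  have g: "bij_betw g {..<n} Q"
    unfolding g_def using bij by (intro bij_betw_inv_into) auto
  have gQ: "g i \<in> Q" if "i < n" for i using g that bij_betwE by blast
  have g0: "\<phi> (g i) 0 = i" if "i < n" for i
    unfolding g_def using bij_betw_inv_into_right[OF bij[of 0]] that by simp
  define r where "r = (\<lambda>i. \<phi> (g i) 1)"
  have r: "bij_betw r {..<n} {..<n}"
    using bij_betw_trans[OF g bij[of 1]] by (simp add: r_def comp_def)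
  define A where "A = {i. g i < n - 1}"
  have ex: "\<exists>T. opt_plan n p q (P 0) (P 1) T \<and> (\<forall>a<n. \<forall>b<n. T a b \<le> T i (r i)) \<and>
      (i \<in> A \<longrightarrow> (\<exists>k<n. T k (q k) = 0)) \<and> (i \<notin> A \<longrightarrow> (\<exists>k<n. T k (p k) = 0))" if "i < n" for i
    using lab[OF gQ[OF that]] g0[OF that]
    by (auto simp: labels_def A_def r_def opt_plan_commute[of n q p] split: if_splits)
  then obtain T where T: "\<And>i. i < n \<Longrightarrow> opt_plan n p q (P 0) (P 1) (T i) \<and>
      (\<forall>a<n. \<forall>b<n. T i a b \<le> T i i (r i)) \<and>
      (i \<in> A \<longrightarrow> (\<exists>k<n. T i k (q k) = 0)) \<and> (i \<notin> A \<longrightarrow> (\<exists>k<n. T i k (p k) = 0))"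
    by metis
  \<comment> \<open>Each kind has only \<open>n - 1\<close> members, so both occur in
    \<open>Q\<close>.\<close>
  have "\<not> Q \<subseteq> {..<n - 1}" "\<not> Q \<subseteq> {n - 1..<2 * n - 2}"
    using card_mono[of "{..<n - 1}" Q] card_mono[of "{n - 1..<2 * n - 2}" Q] \<open>\<not> card Q < n\<close> n by auto
  then obtain u v where uv: "u \<in> Q" "\<not> u < n - 1" "v \<in> Q" "v < n - 1"
    using Q by (auto simp: subset_iff)
  obtain b where b: "b < n" "g b = u" using g uv(1) by (metis bij_betw_def imageE lessThan_iff)
  obtain a where a: "a < n" "g a = v" using g uv(3) by (metis bij_betw_def imageE lessThan_iff)
  show False
    using no_mixed_matching[OF cyc _ r, of "P 0" "P 1" T A a b] divisions_pairD(3)[OF P, of 0] n T a b uv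
    by (auto simp: A_def)
qed

theorem theorem6p11:
  fixes n :: nat
  assumes "n \<ge> 2"
  shows "\<not> ad_arrow (2 * n - 2) [n, n] n \<and>
    ad_number (2 * n - 2) [n, n] < n \<and>
    (\<exists>L. ad_instance (2 * n - 2) [n, n] L \<and>
       (\<forall>P\<in>divisions [n, n]. nu_D (2 * n - 2) [n, n] L P \<le> n - 1))"
proof -
  obtain p q where cyc: "two_matching_cycle n p q"
    using two_matching_cycle_successor[OF assms] by blast
  define L where "L = (\<lambda>i::nat. if i < n - 1 then labels n p q else labels n q p)"
  have inst: "ad_instance (2 * n - 2) [n, n] L"
    unfolding ad_instance_def
  proof (intro allI impI conjI ballI)
    fix i P assume P: "P \<in> divisions [n, n]"
    show "L i P \<subseteq> slice_tuples [n, n]" by (auto simp: L_def labels_def)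
    show "\<exists>j\<in>L i P. \<forall>t<length [n, n]. 0 < P t (j t)"
      using labels_positive[OF P _ cyc] labels_positive[OF P _ two_matching_cycle_commute[OF cyc]] assms
      by (simp add: L_def numeral_2_eq_2)
  next
    fix i j assume "j \<in> slice_tuples [n, n]"
    then show "closedin (top_of_set (divisions [n, n])) {P \<in> divisions [n, n]. j \<in> L i P}"
      using closedin_labels[of n j] assms by (simp add: L_def)
  qed
  have less: "\<not> n \<le> nu_D (2 * n - 2) [n, n] L P" if "P \<in> divisions [n, n]" for P
    using ad_matching_labels_card[OF assms cyc that] unfolding le_nu_D_iff L_def
    by (meson not_le)
  have bound: "m < n" if arrow: "ad_arrow (2 * n - 2) [n, n] m" for m
  proof -
    obtain P where "P \<in> divisions [n, n]" "m \<le> nu_D (2 * n - 2) [n, n] L P"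
      using arrow inst unfolding ad_arrow_def by blast
    then show ?thesis using less[of P] by linarith
  qed
  \<comment> \<open>The greatest element is meaningful only if some \<open>m\<close> qualifies; 0
    does as soon as a division exists, and \<open>bound\<close> limits the rest.\<close>
  have "divisions [n, n] \<noteq> {}"
    unfolding divisions_def PiE_eq_empty_iff using nonempty_standard_simplex by blast
  then have "ad_arrow (2 * n - 2) [n, n] 0"
    by (auto simp: ad_arrow_def)
  then have "ad_arrow (2 * n - 2) [n, n] (ad_number (2 * n - 2) [n, n])"
    unfolding ad_number_def by (rule GreatestI_nat[where b = n]) (use bound in \<open>auto intro: less_imp_le\<close>)
  then have "ad_number (2 * n - 2) [n, n] < n" by (rule bound)
  moreover have "nu_D (2 * n - 2) [n, n] L P \<le> n - 1" if "P \<in> divisions [n, n]" for P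
    using less[OF that] by simp
  ultimately show ?thesis using inst bound by blast
qed

end
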